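(* Let $X$ be a compact metric space, $G_1=\{\mathrm{id}_X,f_1,\dots,f_m\}$ a finite set of continuous self-maps of $X$, and $\Phi\in\mathcal C(X,\mathbb R^m)$ a continuous multi-potential. Then $$P^A(\Phi,G_1)\le P_{free}(\Phi,G_1)\le P_u(\Phi,G_1).$$
   Context: Let $(X,d)$ be a compact metric space, $f_1,\dots,f_m:X\to X$ continuous, $f_{j_1\dots j_n}:=f_{j_1}\circ\dots\circ f_{j_n}$. Let $\Sigma_m^*$ be the set of finite words $C=(i_1,\dots,i_n)$, $n\ge1$, over $\{1,\dots,m\}$, $n(C)=|C|=n$ the length, and $\Sigma_m^+$ the space of sequences $\omega=(\omega_0,\omega_1,\dots)$ over $\{1,\dots,m\}$. For $C=(i_1,\dots,i_n)$, $$B_n(y,C,\varepsilon)=\{z\in X: d(y,z)<\varepsilon,\ d(f_{i_k\dots i_1}(y),f_{i_k\dots i_1}(z))<\varepsilon,\ 1\le k\le n\},$$ $S_n\Phi(y,C)=\phi_{i_1}(y)+\phi_{i_2}(f_{i_1}(y))+\dots+\phi_{i_n}(f_{i_{n-1}\dots i_1}(y))$ for $\Phi=(\phi_1,\dots,\phi_m)$; for $\omega\in\Sigma_m^+$ set $B_n(y,\omega,\varepsilon)=B_n(y,(\omega_0,\dots,\omega_{n-1}),\varepsilon)$ and $S_n\Phi(y,\omega)=S_n\Phi(y,(\omega_0,\dots,\omega_{n-1}))$. Amalgamated pressure $P^A(\Phi,G_1)$ on $X$: $$M(\lambda,\Phi,N,\varepsilon)=\inf_\Gamma\sum_{(C,y)\in\Gamma}\exp(-\lambda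 n(C)+S_{n(C)}\Phi(y,C)),$$ the infimum over at most countable $\Gamma\subset\Sigma_m^*\times X$ with $X\subset\bigcup_{(C,y)\in\Gamma}B_{n(C)}(y,C,\varepsilon)$ and $n(C)\ge N$ for all $(C,y)\in\Gamma$; $m(\lambda,\Phi,\varepsilon)=\lim_{N\to\infty}M(\lambda,\Phi,N,\varepsilon)$; $P^A(\Phi,G_1,\varepsilon)=\inf\{\lambda:m(\lambda,\Phi,\varepsilon)=0\}$; $P^A(\Phi,G_1)=\lim_{\varepsilon\to0}P^A(\Phi,G_1,\varepsilon)$. Upper condensed pressure $P_u(\Phi,G_1)$ on $X$: let $B_n(x,G_1,\varepsilon)=\bigcap_{\omega\in\Sigma_m^+}B_n(x,\omega,\varepsilon)$, $S_n\Phi(x)=\sup_{\omega\in\Sigma_m^+}S_n\Phi(x,\omega)$, and $$M_{u,N}(\Phi,\lambda,\varepsilon)=\inf\sum_{x\in\mathcal F}\exp(S_n\Phi(x)-\lambda n),$$ the infimum over at most countable families of centers $x\in\mathcal F\subset X$ with integers $n=n(x)\ge N$ (allowed to vary with $x$) such that $X\subset\bigcup_{x\in\mathcal F}B_n(x,G_1,\varepsilon)$; $m_u=\lim_{N\to\infty}M_{u,N}$; $P_u(\Phi,G_1,\varepsilon)=\inf\{\lambda:m_u(\Phi,\lambda,\varepsilon)=0\}$; $P_u(\Phi,G_1)=\lim_{\varepsilon\to0}P_u(\Phi,G_1,\varepsilon)$. Free pressure: $$P_{free}(\Phi,G_1)=\lim_{\varepsilon\to0}\limsup_{n\to\infty}\frac1n\log\Big(\frac1{m^n}\sum_{|C|=n}\inf\Big\{\sum_{x\in\mathcal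 F_C}e^{S_n\Phi(x,C)}:\ \mathcal F_C\subset X,\ X=\bigcup_{x\in\mathcal F_C}B_n(x,C,\varepsilon)\Big\}\Big).$$ All pressures take values in the extended reals. *)

theory Defs
  imports "HOL-Analysis.Analysis"
begin

definition words :: "nat \<Rightarrow> nat list set" where
  "words m = {C. C \<noteq> [] \<and> set C \<subseteq> {1..m}}"

definition seqs :: "nat \<Rightarrow> (nat \<Rightarrow> nat) set" where
  "seqs m = {\<omega>. \<forall>k. \<omega> k \<in> {1..m}}"

definition initial_word :: "nat \<Rightarrow> (nat \<Rightarrow> nat) \<Rightarrow> nat list" where
  "initial_word n \<omega> = map \<omega> [0..<n]"

text \<open>\<open>comp_word f [j\<^sub>1, \<dots>, j\<^sub>n]\<close> is \<open>f j\<^sub>1 \<circ> \<dots> \<circ> f j\<^sub>n\<close>, so the last letter acts first.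
  For a word \<open>C = [i\<^sub>1, \<dots>, i\<^sub>n]\<close> the map with index \<open>i\<^sub>k \<dots> i\<^sub>1\<close> is therefore
  \<open>comp_word f (rev (take k C))\<close>; it is the identity for \<open>k = 0\<close>.\<close>

definition comp_word :: "(nat \<Rightarrow> 'a \<Rightarrow> 'a) \<Rightarrow> nat list \<Rightarrow> 'a \<Rightarrow> 'a" where
  "comp_word f js = foldr (\<circ>) (map f js) id"

definition word_ball ::
    "'a::metric_space set \<Rightarrow> (nat \<Rightarrow> 'a \<Rightarrow> 'a) \<Rightarrow> 'a \<Rightarrow> nat list \<Rightarrow> real \<Rightarrow> 'a set" where
  "word_ball X f y C \<epsilon> =
     {z \<in> X. dist y z < \<epsilon> \<and>
        (\<forall>k\<in>{1..length C}.
           dist (comp_word f (rev (take k C)) y) (comp_word f (rev (take k C)) z) < \<epsilon>)}"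

definition word_sum ::
    "(nat \<Rightarrow> 'a \<Rightarrow> 'a) \<Rightarrow> (nat \<Rightarrow> 'a \<Rightarrow> real) \<Rightarrow> 'a \<Rightarrow> nat list \<Rightarrow> real" where
  "word_sum f \<Phi> y C = (\<Sum>k<length C. \<Phi> (C ! k) (comp_word f (rev (take k C)) y))"

text \<open>The sums below range over arbitrary index sets, so they are unordered sums in
  \<^typ>\<open>ennreal\<close>, where they always exist.\<close>

definition amalg_M ::
    "'a::metric_space set \<Rightarrow> nat \<Rightarrow> (nat \<Rightarrow> 'a \<Rightarrow> 'a) \<Rightarrow> (nat \<Rightarrow> 'a \<Rightarrow> real) \<Rightarrow>
     real \<Rightarrow> nat \<Rightarrow> real \<Rightarrow> ennreal" where
  "amalg_M X m f \<Phi> \<alpha> N \<epsilon> =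
     Inf {(\<Sum>\<^sub>\<infinity>(C, y)\<in>\<Gamma>. ennreal (exp (- \<alpha> * real (length C) + word_sum f \<Phi> y C))) | \<Gamma>.
            countable \<Gamma> \<and> \<Gamma> \<subseteq> words m \<times> X \<and>
            X \<subseteq> (\<Union>(C, y)\<in>\<Gamma>. word_ball X f y C \<epsilon>) \<and>
            (\<forall>(C, y)\<in>\<Gamma>. N \<le> length C)}"

definition amalg_lim ::
    "'a::metric_space set \<Rightarrow> nat \<Rightarrow> (nat \<Rightarrow> 'a \<Rightarrow> 'a) \<Rightarrow> (nat \<Rightarrow> 'a \<Rightarrow> real) \<Rightarrow>
     real \<Rightarrow> real \<Rightarrow> ennreal" where
  "amalg_lim X m f \<Phi> \<alpha> \<epsilon> = lim (\<lambda>N. amalg_M X m f \<Phi> \<alpha> N \<epsilon>)"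

definition amalg_pressure_scale ::
    "'a::metric_space set \<Rightarrow> nat \<Rightarrow> (nat \<Rightarrow> 'a \<Rightarrow> 'a) \<Rightarrow> (nat \<Rightarrow> 'a \<Rightarrow> real) \<Rightarrow>
     real \<Rightarrow> ereal" where
  "amalg_pressure_scale X m f \<Phi> \<epsilon> = Inf {ereal \<alpha> | \<alpha>. amalg_lim X m f \<Phi> \<alpha> \<epsilon> = 0}"

definition amalg_pressure ::
    "'a::metric_space set \<Rightarrow> nat \<Rightarrow> (nat \<Rightarrow> 'a \<Rightarrow> 'a) \<Rightarrow> (nat \<Rightarrow> 'a \<Rightarrow> real) \<Rightarrow> ereal" where
  "amalg_pressure X m f \<Phi> = Lim (at_right 0) (\<lambda>\<epsilon>. amalg_pressure_scale X m f \<Phi> \<epsilon>)"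

definition cond_ball ::
    "'a::metric_space set \<Rightarrow> nat \<Rightarrow> (nat \<Rightarrow> 'a \<Rightarrow> 'a) \<Rightarrow> nat \<Rightarrow> 'a \<Rightarrow> real \<Rightarrow> 'a set" where
  "cond_ball X m f n x \<epsilon> = (\<Inter>\<omega>\<in>seqs m. word_ball X f x (initial_word n \<omega>) \<epsilon>)"

definition cond_sum ::
    "nat \<Rightarrow> (nat \<Rightarrow> 'a \<Rightarrow> 'a) \<Rightarrow> (nat \<Rightarrow> 'a \<Rightarrow> real) \<Rightarrow> nat \<Rightarrow> 'a \<Rightarrow> real" where
  "cond_sum m f \<Phi> n x = (SUP \<omega>\<in>seqs m. word_sum f \<Phi> x (initial_word n \<omega>))"

definition cond_M ::
    "'a::metric_space set \<Rightarrow> nat \<Rightarrow> (nat \<Rightarrow> 'a \<Rightarrow> 'a) \<Rightarrow> (nat \<Rightarrow> 'a \<Rightarrow> real) \<Rightarrow>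
     real \<Rightarrow> nat \<Rightarrow> real \<Rightarrow> ennreal" where
  "cond_M X m f \<Phi> \<alpha> N \<epsilon> =
     Inf {(\<Sum>\<^sub>\<infinity>x\<in>F. ennreal (exp (cond_sum m f \<Phi> (n x) x - \<alpha> * real (n x)))) | F n.
            countable F \<and> F \<subseteq> X \<and> (\<forall>x\<in>F. N \<le> n x) \<and>
            X \<subseteq> (\<Union>x\<in>F. cond_ball X m f (n x) x \<epsilon>)}"

definition cond_lim ::
    "'a::metric_space set \<Rightarrow> nat \<Rightarrow> (nat \<Rightarrow> 'a \<Rightarrow> 'a) \<Rightarrow> (nat \<Rightarrow> 'a \<Rightarrow> real) \<Rightarrow>
     real \<Rightarrow> real \<Rightarrow> ennreal" where
  "cond_lim X m f \<Phi> \<alpha> \<epsilon> = lim (\<lambda>N. cond_M X m f \<Phi> \<alpha> N \<epsilon>)"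

definition cond_pressure_scale ::
    "'a::metric_space set \<Rightarrow> nat \<Rightarrow> (nat \<Rightarrow> 'a \<Rightarrow> 'a) \<Rightarrow> (nat \<Rightarrow> 'a \<Rightarrow> real) \<Rightarrow>
     real \<Rightarrow> ereal" where
  "cond_pressure_scale X m f \<Phi> \<epsilon> = Inf {ereal \<alpha> | \<alpha>. cond_lim X m f \<Phi> \<alpha> \<epsilon> = 0}"

definition upper_cond_pressure ::
    "'a::metric_space set \<Rightarrow> nat \<Rightarrow> (nat \<Rightarrow> 'a \<Rightarrow> 'a) \<Rightarrow> (nat \<Rightarrow> 'a \<Rightarrow> real) \<Rightarrow> ereal" where
  "upper_cond_pressure X m f \<Phi> = Lim (at_right 0) (\<lambda>\<epsilon>. cond_pressure_scale X m f \<Phi> \<epsilon>)"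

definition elog :: "ennreal \<Rightarrow> ereal" where
  "elog t = (if t = 0 then - \<infinity> else if t = \<infinity> then \<infinity> else ereal (ln (enn2real t)))"

definition word_cover_inf ::
    "'a::metric_space set \<Rightarrow> (nat \<Rightarrow> 'a \<Rightarrow> 'a) \<Rightarrow> (nat \<Rightarrow> 'a \<Rightarrow> real) \<Rightarrow>
     nat list \<Rightarrow> real \<Rightarrow> ennreal" where
  "word_cover_inf X f \<Phi> C \<epsilon> =
     Inf {(\<Sum>\<^sub>\<infinity>x\<in>F. ennreal (exp (word_sum f \<Phi> x C))) | F.
            F \<subseteq> X \<and> X = (\<Union>x\<in>F. word_ball X f x C \<epsilon>)}"

definition free_average ::
    "'a::metric_space set \<Rightarrow> nat \<Rightarrow> (nat \<Rightarrow> 'a \<Rightarrow> 'a) \<Rightarrow> (nat \<Rightarrow> 'a \<Rightarrow> real) \<Rightarrow>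
     nat \<Rightarrow> real \<Rightarrow> ennreal" where
  "free_average X m f \<Phi> n \<epsilon> =
     1 / of_nat m ^ n * (\<Sum>C\<in>{C \<in> words m. length C = n}. word_cover_inf X f \<Phi> C \<epsilon>)"

definition free_pressure_scale ::
    "'a::metric_space set \<Rightarrow> nat \<Rightarrow> (nat \<Rightarrow> 'a \<Rightarrow> 'a) \<Rightarrow> (nat \<Rightarrow> 'a \<Rightarrow> real) \<Rightarrow>
     real \<Rightarrow> ereal" where
  "free_pressure_scale X m f \<Phi> \<epsilon> =
     limsup (\<lambda>n. ereal (1 / real n) * elog (free_average X m f \<Phi> n \<epsilon>))"

definition free_pressure ::
    "'a::metric_space set \<Rightarrow> nat \<Rightarrow> (nat \<Rightarrow> 'a \<Rightarrow> 'a) \<Rightarrow> (nat \<Rightarrow> 'a \<Rightarrow> real) \<Rightarrow> ereal" where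
  "free_pressure X m f \<Phi> = Lim (at_right 0) (\<lambda>\<epsilon>. free_pressure_scale X m f \<Phi> \<epsilon>)"

text \<open>All the limits above are limits of monotone functions, hence exist; the constants
  \<^const>\<open>lim\<close> and \<^const>\<open>Lim\<close> never take an unspecified value.\<close>

lemma tendsto_at_right_0_antimono:
  fixes g :: "real \<Rightarrow> 'b::{complete_linorder, linorder_topology}"
  assumes "\<And>a b. 0 < a \<Longrightarrow> a \<le> b \<Longrightarrow> g b \<le> g a"
  shows "(g \<longlongrightarrow> (SUP \<epsilon>\<in>{0<..}. g \<epsilon>)) (at_right 0)"
proof (rule order_tendstoI)
  fix a assume "a < (SUP \<epsilon>\<in>{0<..}. g \<epsilon>)"
  then obtain e where e: "0 < e" "a < g e"
    by (auto simp: less_SUP_iff)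
  have "a < g y" if "0 < y" "y < e" for y
    using assms[of y e] e that by (simp add: order_less_le_trans)
  with e(1) show "\<forall>\<^sub>F x in at_right 0. a < g x"
    by (auto simp: eventually_at_right[of 0 1] intro: exI[of _ e])
next
  fix a assume a: "(SUP \<epsilon>\<in>{0<..}. g \<epsilon>) < a"
  have "g y < a" if "0 < y" for y
    using a that by (meson SUP_upper greaterThan_iff order_le_less_trans)
  then show "\<forall>\<^sub>F x in at_right 0. g x < a"
    by (auto simp: eventually_at_right[of 0 1] intro: exI[of _ 1])
qed

lemma word_ball_mono: "a \<le> b \<Longrightarrow> word_ball X f y C a \<subseteq> word_ball X f y C b"
  by (fastforce simp: word_ball_def)

lemma cond_ball_mono: "a \<le> b \<Longrightarrow> cond_ball X m f n x a \<subseteq> cond_ball X m f n x b"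
  unfolding cond_ball_def using word_ball_mono by (intro INF_mono) blast

lemma amalg_M_mono:
  assumes "N \<le> N'" "b \<le> a"
  shows "amalg_M X m f \<Phi> \<alpha> N a \<le> amalg_M X m f \<Phi> \<alpha> N' b"
proof -
  have "X \<subseteq> (\<Union>(C, y)\<in>\<Gamma>. word_ball X f y C b) \<Longrightarrow> X \<subseteq> (\<Union>(C, y)\<in>\<Gamma>. word_ball X f y C a)" for \<Gamma>
    using word_ball_mono[OF assms(2), of X f] by (elim order_trans) (intro UN_mono, auto)
  moreover have "(\<forall>(C, y)\<in>\<Gamma>. N' \<le> length C) \<Longrightarrow> (\<forall>(C, y)\<in>\<Gamma>. N \<le> length C)"
    for \<Gamma> :: "(nat list \<times> 'a) set"
    using assms(1) by fastforce
  ultimately show ?thesis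
    unfolding amalg_M_def by (intro Inf_superset_mono Collect_mono impI ex_mono) iprover
qed

lemma cond_M_mono:
  assumes "N \<le> N'" "b \<le> a"
  shows "cond_M X m f \<Phi> \<alpha> N a \<le> cond_M X m f \<Phi> \<alpha> N' b"
proof -
  have "X \<subseteq> (\<Union>x\<in>F. cond_ball X m f (n x) x b) \<Longrightarrow> X \<subseteq> (\<Union>x\<in>F. cond_ball X m f (n x) x a)"
    for F and n :: "'a \<Rightarrow> nat"
    using cond_ball_mono[OF assms(2), of X m f] by (elim order_trans) (intro UN_mono, auto)
  moreover have "(\<forall>x\<in>F. N' \<le> n x) \<Longrightarrow> (\<forall>x\<in>F. N \<le> n x)" for F and n :: "'a \<Rightarrow> nat"
    using assms(1) by fastforce
  ultimately show ?thesis
    unfolding cond_M_def by (intro Inf_superset_mono Collect_mono impI ex_mono) iprover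
qed

lemma amalg_M_LIMSEQ: "(\<lambda>N. amalg_M X m f \<Phi> \<alpha> N \<epsilon>) \<longlonglongrightarrow> amalg_lim X m f \<Phi> \<alpha> \<epsilon>"
proof -
  have "(\<lambda>N. amalg_M X m f \<Phi> \<alpha> N \<epsilon>) \<longlonglongrightarrow> (SUP N. amalg_M X m f \<Phi> \<alpha> N \<epsilon>)"
    by (intro LIMSEQ_SUP incseq_SucI amalg_M_mono) auto
  then show ?thesis
    by (simp add: amalg_lim_def limI)
qed

lemma cond_M_LIMSEQ: "(\<lambda>N. cond_M X m f \<Phi> \<alpha> N \<epsilon>) \<longlonglongrightarrow> cond_lim X m f \<Phi> \<alpha> \<epsilon>"
proof -
  have "(\<lambda>N. cond_M X m f \<Phi> \<alpha> N \<epsilon>) \<longlonglongrightarrow> (SUP N. cond_M X m f \<Phi> \<alpha> N \<epsilon>)"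
    by (intro LIMSEQ_SUP incseq_SucI cond_M_mono) auto
  then show ?thesis
    by (simp add: cond_lim_def limI)
qed

lemma amalg_pressure_scale_antimono:
  assumes "a \<le> b"
  shows "amalg_pressure_scale X m f \<Phi> b \<le> amalg_pressure_scale X m f \<Phi> a"
proof -
  have "amalg_lim X m f \<Phi> \<alpha> b \<le> amalg_lim X m f \<Phi> \<alpha> a" for \<alpha>
    by (rule LIMSEQ_le[OF amalg_M_LIMSEQ amalg_M_LIMSEQ]) (use assms in \<open>auto intro: amalg_M_mono\<close>)
  then have "amalg_lim X m f \<Phi> \<alpha> a = 0 \<Longrightarrow> amalg_lim X m f \<Phi> \<alpha> b = 0" for \<alpha>
    by (metis le_zero_eq)
  then show ?thesis
    unfolding amalg_pressure_scale_def by (intro Inf_superset_mono) blast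
qed

lemma cond_pressure_scale_antimono:
  assumes "a \<le> b"
  shows "cond_pressure_scale X m f \<Phi> b \<le> cond_pressure_scale X m f \<Phi> a"
proof -
  have "cond_lim X m f \<Phi> \<alpha> b \<le> cond_lim X m f \<Phi> \<alpha> a" for \<alpha>
    by (rule LIMSEQ_le[OF cond_M_LIMSEQ cond_M_LIMSEQ]) (use assms in \<open>auto intro: cond_M_mono\<close>)
  then have "cond_lim X m f \<Phi> \<alpha> a = 0 \<Longrightarrow> cond_lim X m f \<Phi> \<alpha> b = 0" for \<alpha>
    by (metis le_zero_eq)
  then show ?thesis
    unfolding cond_pressure_scale_def by (intro Inf_superset_mono) blast
qed

lemma elog_mono:
  assumes "s \<le> t"
  shows "elog s \<le> elog t"
proof (cases "s = 0 \<or> t = \<infinity>")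
  case True
  then show ?thesis by (auto simp: elog_def)
next
  case False
  with assms have *: "s \<noteq> 0" "s < top" "t \<noteq> 0" "t < top"
    by (auto simp: top.not_eq_extremum)
  then have "0 < enn2real s" "enn2real s \<le> enn2real t"
    using assms by (auto simp: enn2real_positive_iff zero_less_iff_neq_zero enn2real_mono)
  with * show ?thesis
    by (auto simp: elog_def)
qed

lemma word_cover_inf_antimono:
  assumes "a \<le> b"
  shows "word_cover_inf X f \<Phi> C b \<le> word_cover_inf X f \<Phi> C a"
proof -
  have "X = (\<Union>x\<in>F. word_ball X f x C a) \<Longrightarrow> X = (\<Union>x\<in>F. word_ball X f x C b)" for F
  proof (intro equalityI)
    assume "X = (\<Union>x\<in>F. word_ball X f x C a)"
    also have "\<dots> \<subseteq> (\<Union>x\<in>F. word_ball X f x C b)"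
      by (intro UN_mono word_ball_mono assms order_refl)
    finally show "X \<subseteq> (\<Union>x\<in>F. word_ball X f x C b)" .
  qed (auto simp: word_ball_def)
  then show ?thesis
    unfolding word_cover_inf_def by (intro Inf_superset_mono Collect_mono impI ex_mono) iprover
qed

lemma free_pressure_scale_antimono:
  assumes "a \<le> b"
  shows "free_pressure_scale X m f \<Phi> b \<le> free_pressure_scale X m f \<Phi> a"
  unfolding free_pressure_scale_def free_average_def
  by (intro Limsup_mono always_eventually allI ereal_mult_left_mono elog_mono mult_left_mono
      sum_mono word_cover_inf_antimono assms) auto

lemma amalg_pressure_tendsto:
  "((\<lambda>\<epsilon>. amalg_pressure_scale X m f \<Phi> \<epsilon>) \<longlongrightarrow> amalg_pressure X m f \<Phi>) (at_right 0)"
  unfolding amalg_pressure_def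
  using tendsto_at_right_0_antimono[of "amalg_pressure_scale X m f \<Phi>"]
  by (metis amalg_pressure_scale_antimono tendsto_Lim trivial_limit_at_right_real)

lemma cond_pressure_tendsto:
  "((\<lambda>\<epsilon>. cond_pressure_scale X m f \<Phi> \<epsilon>) \<longlongrightarrow> upper_cond_pressure X m f \<Phi>) (at_right 0)"
  unfolding upper_cond_pressure_def
  using tendsto_at_right_0_antimono[of "cond_pressure_scale X m f \<Phi>"]
  by (metis cond_pressure_scale_antimono tendsto_Lim trivial_limit_at_right_real)

lemma free_pressure_tendsto:
  "((\<lambda>\<epsilon>. free_pressure_scale X m f \<Phi> \<epsilon>) \<longlongrightarrow> free_pressure X m f \<Phi>) (at_right 0)"
  unfolding free_pressure_def
  using tendsto_at_right_0_antimono[of "free_pressure_scale X m f \<Phi>"]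
  by (metis free_pressure_scale_antimono tendsto_Lim trivial_limit_at_right_real)

end

theory Submission
  imports Defs
begin

text \<open>
  The first inequality already holds at every scale \<open>\<epsilon>\<close>: for each \<open>n\<close> some word of length \<open>n\<close> has
  covering sum at most the average, and a cover for that single word is admissible in the
  amalgamated infimum.

  For the second inequality let \<open>V\<close> bound the oscillation of the potentials at scale \<open>\<epsilon>\<close>; then
  the free pressure at scale \<open>2\<epsilon>\<close> is at most the condensed pressure at scale \<open>\<epsilon>\<close> plus \<open>V\<close>.
  If \<open>\<alpha>\<close> exceeds the latter pressure, compactness gives a finite cover by condensed balls of
  varying lengths \<open>n x \<ge> 1\<close> whose weights \<open>exp (S x - \<alpha> n x)\<close> sum to at most 1. Condensed balls
  control all words at once, so along any word \<open>C\<close> they can be concatenated: a point is in some ball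
  for an initial segment of \<open>C\<close>, its image is in some ball for the next segment, and so on.
  By induction on the length of \<open>C\<close>, \<open>X\<close> splits into pieces that are \<open>2\<epsilon>\<close>-small along \<open>C\<close> and have
  total weight at most \<open>K exp ((\<alpha> + V) |C|)\<close> with \<open>K\<close> independent of \<open>C\<close>.
\<close>

section \<open>Orbits, Birkhoff sums and dynamical balls along concatenated words\<close>

abbreviation orbit :: "(nat \<Rightarrow> 'a \<Rightarrow> 'a) \<Rightarrow> nat list \<Rightarrow> 'a \<Rightarrow> 'a" where
  "orbit f C \<equiv> comp_word f (rev C)"

lemma comp_word_Nil [simp]: "comp_word f [] y = y"
  by (simp add: comp_word_def)

lemma orbit_append: "orbit f (A @ D) y = orbit f D (orbit f A y)"
proof -
  \<comment> \<open>A general start value \<open>h\<close> makes the induction work; it is then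
    taken to be the fold over \<open>rev A\<close>, since \<open>rev (A @ D)\<close> ends in
    \<open>rev A\<close>.\<close>
  have "foldr (\<circ>) gs h y = foldr (\<circ>) gs id (h y)" for gs :: "('a \<Rightarrow> 'a) list" and h
    by (induction gs) auto
  from this[of "map f (rev D)" "foldr (\<circ>) (map f (rev A)) id"] show ?thesis
    by (simp add: comp_word_def)
qed

lemma orbit_snoc: "orbit f (A @ [i]) y = f i (orbit f A y)"
  unfolding orbit_append by (simp add: comp_word_def)

text \<open>The cocycle identity: the terms past \<open>length A\<close> are those of
  \<open>D\<close> started at the endpoint of the orbit along \<open>A\<close>.\<close>

lemma word_sum_append: "word_sum f \<Phi> y (A @ D) = word_sum f \<Phi> y A + word_sum f \<Phi> (orbit f A y) D"
proof -
  have split: "(\<Sum>k<a + d. h k) = (\<Sum>k<a. h k) + (\<Sum>k<d. h (a + k))" for a d and h :: "nat \<Rightarrow> real"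
    by (induction d) auto
  have "word_sum f \<Phi> y (A @ D) = (\<Sum>k<length A. \<Phi> ((A @ D) ! k) (orbit f (take k (A @ D)) y)) +
      (\<Sum>k<length D. \<Phi> ((A @ D) ! (length A + k)) (orbit f (take (length A + k) (A @ D)) y))"
    unfolding word_sum_def length_append by (rule split)
  also have "\<dots> = word_sum f \<Phi> y A + word_sum f \<Phi> (orbit f A y) D"
    unfolding word_sum_def by (intro arg_cong2[of _ _ _ _ "(+)"] sum.cong)
      (auto simp: nth_append orbit_append simp del: rev_append)
  finally show ?thesis .
qed

text \<open>Letting \<open>k\<close> start at 0 absorbs the separate condition on
  \<open>dist y z\<close>, because the empty word acts as the identity.\<close>

lemma word_ball_iff:
  "z \<in> word_ball X f y C \<epsilon> \<longleftrightarrow>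
     z \<in> X \<and> (\<forall>k\<le>length C. dist (orbit f (take k C) y) (orbit f (take k C) z) < \<epsilon>)"
proof -
  have "(\<forall>k\<le>n. P k) \<longleftrightarrow> P 0 \<and> (\<forall>k\<in>{1..n}. P k)" for n and P :: "nat \<Rightarrow> bool"
    by (metis atLeastAtMost_iff less_one linorder_not_less zero_le)
  then show ?thesis
    unfolding word_ball_def by simp
qed

text \<open>Turns intersections and suprema over the infinite set of sequences into finite ones;
  this keeps condensed balls open and the real supremum in \<open>cond_sum\<close> bounded.\<close>

lemma initial_words_eq: "m \<ge> 1 \<Longrightarrow> initial_word n ` seqs m = {C. set C \<subseteq> {1..m} \<and> length C = n}"
proof (intro equalityI subsetI)
  fix C assume m: "m \<ge> 1" and C: "C \<in> {C. set C \<subseteq> {1..m} \<and> length C = n}"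
  \<comment> \<open>Beyond its end the word is continued by the letter 1, available because
    \<open>m \<ge> 1\<close>.\<close>
  define \<omega> where "\<omega> = (\<lambda>k. if k < n then C ! k else 1)"
  have "C = initial_word n \<omega>"
    using C by (intro nth_equalityI) (auto simp: initial_word_def \<omega>_def)
  moreover have "\<omega> \<in> seqs m"
    using C m unfolding seqs_def \<omega>_def by (auto simp: subset_iff)
  ultimately show "C \<in> initial_word n ` seqs m" by blast
qed (auto simp: initial_word_def seqs_def)

lemma finite_infsum_le_ennreal:
  fixes g :: "'b \<Rightarrow> ennreal"
  assumes "finite F'" "F' \<subseteq> F"
  shows "sum g F' \<le> infsum g F"
proof -
  have "infsum g F' \<le> infsum g F"
    using assms(2) by (intro infsum_mono_neutral nonneg_summable_on_complete) auto
  then show ?thesis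
    using assms(1) by simp
qed

section \<open>Finite covers with weights\<close>

text \<open>\<open>A\<close> is a finite union of sets satisfying \<open>P\<close>, of total weight
  at most \<open>c\<close>; the slack sits in the rule \<open>empty\<close>. The inductive form
  avoids index sets, so a set may occur repeatedly with different weights.\<close>

inductive weighted_cover :: "('a set \<Rightarrow> real \<Rightarrow> bool) \<Rightarrow> 'a set \<Rightarrow> real \<Rightarrow> bool" for P where
  empty: "0 \<le> c \<Longrightarrow> weighted_cover P {} c"
| insert: "P E w \<Longrightarrow> weighted_cover P A c \<Longrightarrow> weighted_cover P (E \<union> A) (w + c)"

lemma weighted_cover_mono:
  assumes "weighted_cover P A c" "c \<le> d"
  shows "weighted_cover P A d"
  using assms
proof (induction arbitrary: d)
  case (insert E w A c)
  then have "weighted_cover P (E \<union> A) (w + (d - w))"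
    by (intro weighted_cover.insert) auto
  then show ?case by simp
qed (auto intro: weighted_cover.empty)

lemma weighted_cover_Un:
  assumes "weighted_cover P A c" "weighted_cover P B d"
  shows "weighted_cover P (A \<union> B) (c + d)"
  using assms
proof induction
  case (empty c)
  then show ?case by (auto intro: weighted_cover_mono)
next
  case (insert E w A c)
  then show ?case
    using weighted_cover.insert[of P E w "A \<union> B" "c + d"] by (simp add: ac_simps Un_assoc)
qed

lemma weighted_cover_UN:
  assumes "finite I" "\<And>i. i \<in> I \<Longrightarrow> weighted_cover P (A i) (c i)"
  shows "weighted_cover P (\<Union>i\<in>I. A i) (\<Sum>i\<in>I. c i)"
  using assms by (induction I) (auto intro: weighted_cover.empty weighted_cover_Un)

text \<open>One concatenation step: with \<open>g\<close> the orbit map of a first segment,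
  \<open>B\<close> a ball along it and \<open>b\<close> its weight, a cover for the remaining word
  is pulled back to \<open>B\<close>.\<close>

lemma weighted_cover_transfer:
  assumes "weighted_cover P A c" "0 \<le> b"
    and "\<And>E w. P E w \<Longrightarrow> Q (B \<inter> g -` E) (b * w)"
  shows "weighted_cover Q (B \<inter> g -` A) (b * c)"
  using assms(1)
proof induction
  case (empty c)
  then show ?case using assms(2) by (auto intro: weighted_cover.empty)
next
  case (insert E w A c)
  then show ?case
    using weighted_cover.insert[of Q, OF assms(3)] by (simp add: distrib_left Int_Un_distrib)
qed

text \<open>Pieces are sets without a distinguished center: a center for the whole word is chosen only
  after all concatenations, so that the radius doubles once and not at every step.\<close>

definition piece ::
    "'a::metric_space set \<Rightarrow> (nat \<Rightarrow> 'a \<Rightarrow> 'a) \<Rightarrow> (nat \<Rightarrow> 'a \<Rightarrow> real) \<Rightarrow> real \<Rightarrow> nat list \<Rightarrow>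
     'a set \<Rightarrow> real \<Rightarrow> bool" where
  "piece X f \<Phi> \<epsilon> C E w \<longleftrightarrow> E \<subseteq> X \<and> 0 \<le> w \<and>
     (\<forall>y\<in>E. \<forall>z\<in>E. z \<in> word_ball X f y C \<epsilon>) \<and> (\<forall>y\<in>E. exp (word_sum f \<Phi> y C) \<le> w)"

text \<open>Any point of a nonempty piece can serve as its center, since the points of a piece are
  pairwise close along \<open>C\<close> and the weight bounds the exponential at each of
  them.\<close>

lemma weighted_cover_centers:
  assumes "weighted_cover (piece X f \<Phi> \<epsilon> C) A c"
  obtains Y where "finite Y" "Y \<subseteq> X" "A \<subseteq> (\<Union>y\<in>Y. word_ball X f y C \<epsilon>)"
    "(\<Sum>y\<in>Y. exp (word_sum f \<Phi> y C)) \<le> c"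
proof -
  from assms have "\<exists>Y. finite Y \<and> Y \<subseteq> X \<and> A \<subseteq> (\<Union>y\<in>Y. word_ball X f y C \<epsilon>) \<and>
    (\<Sum>y\<in>Y. exp (word_sum f \<Phi> y C)) \<le> c"
  proof induction
    case (empty c)
    then show ?case by (intro exI[of _ "{}"]) auto
  next
    case (insert E w A c)
    then obtain Y where Y: "finite Y" "Y \<subseteq> X" "A \<subseteq> (\<Union>y\<in>Y. word_ball X f y C \<epsilon>)"
      "(\<Sum>y\<in>Y. exp (word_sum f \<Phi> y C)) \<le> c" by blast
    note E = insert.hyps(1)[unfolded piece_def]
    show ?case
    \<comment> \<open>An empty piece gets no center; its weight is nonnegative, so the bound
      survives.\<close>
    proof (cases "E = {}")
      case True
      then show ?thesis using Y E by (intro exI[of _ Y]) auto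
    next
      case False
      then obtain y where y: "y \<in> E" by blast
      \<comment> \<open>Only an inequality, because \<open>y\<close> may already be in
        \<open>Y\<close>.\<close>
      have "(\<Sum>y\<in>insert y Y. exp (word_sum f \<Phi> y C)) \<le>
          exp (word_sum f \<Phi> y C) + (\<Sum>y\<in>Y. exp (word_sum f \<Phi> y C))"
        using Y(1) by (simp add: sum.insert_if)
      also have "\<dots> \<le> w + c"
        using E y Y(4) by (intro add_mono) auto
      finally show ?thesis
        using Y E y by (intro exI[of _ "insert y Y"]) auto
    qed
  qed
  then show thesis using that by blast
qed

section \<open>Openness of balls and passage to finite subcovers\<close>

locale free_system =
  fixes X :: "'a::metric_space set" and m :: nat
    and f :: "nat \<Rightarrow> 'a \<Rightarrow> 'a" and \<Phi> :: "nat \<Rightarrow> 'a \<Rightarrow> real"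
  assumes compact_X: "compact X"
    and m_pos: "m \<ge> 1"
    and f_into: "\<And>i. i \<in> {1..m} \<Longrightarrow> f i ` X \<subseteq> X"
    and f_cont: "\<And>i. i \<in> {1..m} \<Longrightarrow> continuous_on X (f i)"
    and \<Phi>_cont: "\<And>i. i \<in> {1..m} \<Longrightarrow> continuous_on X (\<Phi> i)"
begin

lemma orbit_props:
  assumes "set C \<subseteq> {1..m}"
  shows orbit_into: "orbit f C ` X \<subseteq> X" and continuous_on_orbit: "continuous_on X (orbit f C)"
proof -
  have "orbit f C ` X \<subseteq> X \<and> continuous_on X (orbit f C)"
    using assms
  proof (induction C rule: rev_induct)
    case Nil
    then show ?case by (simp add: comp_word_def)
  next
    case (snoc i C)
    then have IH: "orbit f C ` X \<subseteq> X" "continuous_on X (orbit f C)" and i: "i \<in> {1..m}"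
      by auto
    have eq: "orbit f (C @ [i]) = f i \<circ> orbit f C"
      by (rule ext) (simp add: orbit_snoc del: rev_append)
    have "continuous_on X (f i \<circ> orbit f C)"
      using IH f_cont[OF i] by (intro continuous_on_compose) (auto intro: continuous_on_subset)
    moreover have "(f i \<circ> orbit f C) ` X \<subseteq> X"
      using IH f_into[OF i] by auto
    ultimately show ?case unfolding eq by blast
  qed
  then show "orbit f C ` X \<subseteq> X" "continuous_on X (orbit f C)" by auto
qed

lemma openin_word_ball:
  assumes "set C \<subseteq> {1..m}"
  shows "openin (top_of_set X) (word_ball X f y C \<epsilon>)"
proof -
  have "word_ball X f y C \<epsilon> =
      (\<Inter>k\<in>{..length C}. X \<inter> orbit f (take k C) -` ball (orbit f (take k C) y) \<epsilon>)"
    by (auto simp: word_ball_iff)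
  moreover have "set (take k C) \<subseteq> {1..m}" for k
    using assms set_take_subset by fast
  ultimately show ?thesis
    by (simp only:) (intro openin_INT2 continuous_openin_preimage_gen continuous_on_orbit, auto)
qed

lemma openin_cond_ball: "openin (top_of_set X) (cond_ball X m f n x \<epsilon>)"
proof -
  define W where "W = {C. set C \<subseteq> {1..m} \<and> length C = n}"
  have W: "initial_word n ` seqs m = W"
    unfolding W_def using m_pos by (rule initial_words_eq)
  have "cond_ball X m f n x \<epsilon> = (\<Inter>C\<in>W. word_ball X f x C \<epsilon>)"
    unfolding cond_ball_def W[symmetric] by simp
  moreover have "finite W"
    unfolding W_def by (rule finite_lists_length_eq) simp
  \<comment> \<open>An empty intersection would be the whole type rather than a subset of
    \<open>X\<close>.\<close>
  moreover have "W \<noteq> {}"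
    unfolding W[symmetric] using m_pos by (auto simp: seqs_def)
  ultimately show ?thesis
    using openin_word_ball by (auto simp: W_def intro!: openin_INT2)
qed

lemma finite_subcover:
  assumes "X \<subseteq> (\<Union>x\<in>F. B x)" "\<And>x. x \<in> F \<Longrightarrow> openin (top_of_set X) (B x)"
  obtains F' where "finite F'" "F' \<subseteq> F" "X \<subseteq> (\<Union>x\<in>F'. B x)"
proof -
  have "\<forall>\<U>. (\<forall>U\<in>\<U>. openin (top_of_set X) U) \<and> X \<subseteq> \<Union>\<U> \<longrightarrow> (\<exists>\<F>\<subseteq>\<U>. finite \<F> \<and> X \<subseteq> \<Union>\<F>)"
    using compact_X compact_eq_openin_cover by blast
  from this[rule_format, of "B ` F"] assms obtain \<F> where "\<F> \<subseteq> B ` F" "finite \<F>" "X \<subseteq> \<Union>\<F>"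
    by auto
  then show thesis
    using that by (metis finite_subset_image)
qed

lemma word_sum_le_cond_sum:
  assumes "set C \<subseteq> {1..m}"
  shows "word_sum f \<Phi> x C \<le> cond_sum m f \<Phi> (length C) x"
proof -
  define W where "W = {D. set D \<subseteq> {1..m} \<and> length D = length C}"
  have W: "initial_word (length C) ` seqs m = W"
    unfolding W_def using m_pos by (rule initial_words_eq)
  have "finite W"
    unfolding W_def by (rule finite_lists_length_eq) simp
  then have "word_sum f \<Phi> x C \<le> (SUP D\<in>W. word_sum f \<Phi> x D)"
    using assms by (intro cSUP_upper) (auto simp: W_def)
  then show ?thesis
    unfolding cond_sum_def W[symmetric] by (simp add: image_comp)
qed

text \<open>Compactness gives a finite subfamily, and dropping nonnegative terms keeps the strict
  bound. The covers in \<open>word_cover_inf\<close> may be uncountable, whereas the amalgamated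
  infimum asks for countable ones.\<close>

lemma word_cover_inf_lessE:
  assumes "set C \<subseteq> {1..m}" "word_cover_inf X f \<Phi> C \<epsilon> < t"
  obtains F where "finite F" "F \<subseteq> X" "X \<subseteq> (\<Union>x\<in>F. word_ball X f x C \<epsilon>)"
    "(\<Sum>x\<in>F. ennreal (exp (word_sum f \<Phi> x C))) < t"
proof -
  from assms(2) obtain F where F: "F \<subseteq> X" "X = (\<Union>x\<in>F. word_ball X f x C \<epsilon>)"
    "(\<Sum>\<^sub>\<infinity>x\<in>F. ennreal (exp (word_sum f \<Phi> x C))) < t"
    unfolding word_cover_inf_def Inf_less_iff by blast
  obtain F' where F': "finite F'" "F' \<subseteq> F" "X \<subseteq> (\<Union>x\<in>F'. word_ball X f x C \<epsilon>)"
    using finite_subcover[OF equalityD1[OF F(2)] openin_word_ball[OF assms(1)]] by metis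
  have "(\<Sum>x\<in>F'. ennreal (exp (word_sum f \<Phi> x C))) < t"
    using finite_infsum_le_ennreal[OF F'(1,2)] F(3) by (rule order_le_less_trans)
  with F' F(1) show thesis
    using that by blast
qed

section \<open>Averages over words, and amalgamated against free pressure\<close>

lemma words_of_length:
  assumes "n \<ge> 1"
  shows "finite {C \<in> words m. length C = n}" "card {C \<in> words m. length C = n} = m ^ n"
proof -
  have "{C \<in> words m. length C = n} = {C. set C \<subseteq> {1..m} \<and> length C = n}"
    using assms by (auto simp: words_def)
  then show "finite {C \<in> words m. length C = n}" "card {C \<in> words m. length C = n} = m ^ n"
    by (simp_all add: finite_lists_length_eq card_lists_length_eq)
qed

text \<open>The factor \<open>m ^ n\<close> cancels because it is neither 0 nor infinite;
  \<open>t\<close> itself may be infinite.\<close>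

lemma mean_of_constant: "1 / of_nat m ^ n * (of_nat (m ^ n) * (t :: ennreal)) = t"
proof -
  have "of_nat (m ^ n) \<noteq> (0 :: ennreal)" "of_nat (m ^ n) \<noteq> (top :: ennreal)"
    using m_pos by (simp_all add: ennreal_of_nat_neq_top del: of_nat_power)
  then have "1 / of_nat (m ^ n) * (of_nat (m ^ n) :: ennreal) = 1"
    by (simp add: ennreal_divide_times ennreal_divide_self top.not_eq_extremum)
  then show ?thesis
    by (simp flip: mult.assoc)
qed

lemma free_average_leI:
  assumes "n \<ge> 1" "\<And>C. set C \<subseteq> {1..m} \<Longrightarrow> length C = n \<Longrightarrow> word_cover_inf X f \<Phi> C \<epsilon> \<le> t"
  shows "free_average X m f \<Phi> n \<epsilon> \<le> t"
proof -
  have "(\<Sum>C\<in>{C \<in> words m. length C = n}. word_cover_inf X f \<Phi> C \<epsilon>) \<le> of_nat (m ^ n) * t"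
    using sum_bounded_above[of "{C \<in> words m. length C = n}" "\<lambda>C. word_cover_inf X f \<Phi> C \<epsilon>" t]
      assms by (simp add: words_of_length) (simp add: words_def)
  then have "free_average X m f \<Phi> n \<epsilon> \<le> 1 / of_nat m ^ n * (of_nat (m ^ n) * t)"
    unfolding free_average_def by (intro mult_left_mono) auto
  then show ?thesis
    by (simp only: mean_of_constant)
qed

lemma free_average_lessE:
  assumes "n \<ge> 1" "free_average X m f \<Phi> n \<epsilon> < t"
  obtains C where "C \<in> words m" "length C = n" "word_cover_inf X f \<Phi> C \<epsilon> < t"
proof (rule ccontr)
  note * = that
  assume no_word: "\<not> thesis"
  have "t \<le> word_cover_inf X f \<Phi> C \<epsilon>" if C: "C \<in> {C \<in> words m. length C = n}" for C
  proof (rule ccontr)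
    assume "\<not> ?thesis"
    with *[of C] C no_word show False by (auto simp: not_le)
  qed
  then have "of_nat (m ^ n) * t \<le> (\<Sum>C\<in>{C \<in> words m. length C = n}. word_cover_inf X f \<Phi> C \<epsilon>)"
    using sum_bounded_below[of "{C \<in> words m. length C = n}" t "\<lambda>C. word_cover_inf X f \<Phi> C \<epsilon>"] assms(1)
    by (simp add: words_of_length)
  then have "1 / of_nat m ^ n * (of_nat (m ^ n) * t) \<le> free_average X m f \<Phi> n \<epsilon>"
    unfolding free_average_def by (intro mult_left_mono) auto
  then show False
    using assms(2) by (simp only: mean_of_constant)
qed

lemma elog_ennreal: "0 < r \<Longrightarrow> elog (ennreal r) = ereal (ln r)"
  by (simp add: elog_def)

lemma amalg_M_le:
  assumes "n \<ge> 1" "free_average X m f \<Phi> n \<epsilon> < ennreal (exp (\<beta> * n))"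
  shows "amalg_M X m f \<Phi> \<alpha> n \<epsilon> \<le> ennreal (exp ((\<beta> - \<alpha>) * n))"
proof -
  obtain C where C: "C \<in> words m" "length C = n" "word_cover_inf X f \<Phi> C \<epsilon> < ennreal (exp (\<beta> * n))"
    using free_average_lessE[OF assms] by blast
  then have "set C \<subseteq> {1..m}" by (auto simp: words_def)
  from word_cover_inf_lessE[OF this C(3)] obtain F where F: "finite F" "F \<subseteq> X"
    "X \<subseteq> (\<Union>x\<in>F. word_ball X f x C \<epsilon>)"
    "(\<Sum>x\<in>F. ennreal (exp (word_sum f \<Phi> x C))) < ennreal (exp (\<beta> * n))" by blast
  \<comment> \<open>The same word is paired with every center.\<close>
  define \<Gamma> where "\<Gamma> = Pair C ` F"
  have "amalg_M X m f \<Phi> \<alpha> n \<epsilon> \<le>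
      (\<Sum>\<^sub>\<infinity>(C, y)\<in>\<Gamma>. ennreal (exp (- \<alpha> * real (length C) + word_sum f \<Phi> y C)))"
    unfolding amalg_M_def
    by (rule Inf_lower, rule CollectI, rule exI[of _ \<Gamma>])
      (use F C in \<open>auto simp: \<Gamma>_def intro: countable_finite\<close>)
  also have "\<dots> = (\<Sum>(C, y)\<in>\<Gamma>. ennreal (exp (- \<alpha> * real (length C) + word_sum f \<Phi> y C)))"
    using F(1) by (simp add: \<Gamma>_def)
  also have "\<dots> = (\<Sum>y\<in>F. ennreal (exp (- \<alpha> * n + word_sum f \<Phi> y C)))"
    unfolding \<Gamma>_def by (subst sum.reindex) (auto simp: inj_on_def C(2))
  also have "\<dots> = ennreal (exp (- \<alpha> * n)) * (\<Sum>y\<in>F. ennreal (exp (word_sum f \<Phi> y C)))"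
    unfolding exp_add by (simp add: ennreal_mult sum_distrib_left del: sum_ennreal)
  also have "\<dots> \<le> ennreal (exp (- \<alpha> * n)) * ennreal (exp (\<beta> * n))"
    using F(4) by (intro mult_left_mono less_imp_le) auto
  also have "\<dots> = ennreal (exp ((\<beta> - \<alpha>) * n))"
    by (simp add: algebra_simps flip: ennreal_mult exp_add)
  finally show ?thesis .
qed

lemma amalg_le_free_scale: "amalg_pressure_scale X m f \<Phi> \<epsilon> \<le> free_pressure_scale X m f \<Phi> \<epsilon>"
proof (rule ccontr)
  assume "\<not> ?thesis"
  then obtain \<alpha> where \<alpha>: "free_pressure_scale X m f \<Phi> \<epsilon> < ereal \<alpha>"
    "ereal \<alpha> < amalg_pressure_scale X m f \<Phi> \<epsilon>"
    using ereal_dense2[of "free_pressure_scale X m f \<Phi> \<epsilon>"] by (auto simp: not_le)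
  \<comment> \<open>The gap between \<beta> and \<alpha> makes the bound
    \<open>exp ((\<beta> - \<alpha>) * n)\<close> tend to 0.\<close>
  then obtain \<beta> where \<beta>: "free_pressure_scale X m f \<Phi> \<epsilon> < ereal \<beta>" "\<beta> < \<alpha>"
    using ereal_dense2[OF \<alpha>(1)] by auto
  from \<beta>(1) have "\<forall>\<^sub>F n in sequentially.
      ereal (1 / real n) * elog (free_average X m f \<Phi> n \<epsilon>) < ereal \<beta>"
    unfolding free_pressure_scale_def by (rule Limsup_lessD)
  then have ev: "\<forall>\<^sub>F n in sequentially. amalg_M X m f \<Phi> \<alpha> n \<epsilon> \<le> ennreal (exp ((\<beta> - \<alpha>) * n))"
    using eventually_ge_at_top[of 1]
  proof eventually_elim
    case (elim n)
    have "free_average X m f \<Phi> n \<epsilon> < ennreal (exp (\<beta> * n))"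
    proof (rule ccontr)
      assume "\<not> ?thesis"
      then have "elog (ennreal (exp (\<beta> * n))) \<le> elog (free_average X m f \<Phi> n \<epsilon>)"
        by (intro elog_mono) auto
      then have "ereal (1 / real n) * ereal (\<beta> * n) \<le>
          ereal (1 / real n) * elog (free_average X m f \<Phi> n \<epsilon>)"
        by (intro ereal_mult_left_mono) (auto simp: elog_ennreal)
      then show False
        using elim by (simp add: field_simps)
    qed
    then show ?case
      using elim by (intro amalg_M_le) auto
  qed
  have "(\<lambda>n. exp ((\<beta> - \<alpha>) * real n)) = (\<lambda>n. exp (\<beta> - \<alpha>) ^ n)"
    by (simp add: exp_of_nat_mult mult.commute)
  then have "(\<lambda>n. exp ((\<beta> - \<alpha>) * real n)) \<longlonglongrightarrow> 0"
    using \<beta>(2) by (simp add: LIMSEQ_power_zero)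
  then have "(\<lambda>n. ennreal (exp ((\<beta> - \<alpha>) * real n))) \<longlonglongrightarrow> 0"
    using tendsto_ennrealI by fastforce
  from tendsto_le[OF _ this amalg_M_LIMSEQ ev] have "amalg_lim X m f \<Phi> \<alpha> \<epsilon> = 0"
    by simp
  then have "amalg_pressure_scale X m f \<Phi> \<epsilon> \<le> ereal \<alpha>"
    unfolding amalg_pressure_scale_def by (auto intro: Inf_lower)
  with \<alpha>(2) show False by simp
qed

section \<open>Oscillation and size of the potentials along orbits\<close>

definition osc_le :: "real \<Rightarrow> real \<Rightarrow> bool" where
  "osc_le \<epsilon> V \<longleftrightarrow> (\<forall>i\<in>{1..m}. \<forall>x\<in>X. \<forall>y\<in>X. dist x y < \<epsilon> \<longrightarrow> \<bar>\<Phi> i x - \<Phi> i y\<bar> \<le> V)"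

definition potential_bound :: "real \<Rightarrow> bool" where
  "potential_bound M \<longleftrightarrow> (\<forall>i\<in>{1..m}. \<forall>x\<in>X. \<bar>\<Phi> i x\<bar> \<le> M)"

text \<open>Bounded distortion: the two orbits stay \<epsilon>-close, so each of the
  \<open>length C\<close> terms changes by at most \<open>V\<close>.\<close>

lemma word_sum_diff_le:
  fixes V :: real
  assumes osc: "osc_le \<epsilon> V"
    and "set C \<subseteq> {1..m}" "x \<in> X" "y \<in> word_ball X f x C \<epsilon>"
  shows "word_sum f \<Phi> y C \<le> word_sum f \<Phi> x C + length C * V"
proof -
  have "word_sum f \<Phi> y C \<le> (\<Sum>k<length C. \<Phi> (C ! k) (orbit f (take k C) x) + V)"
    unfolding word_sum_def
  proof (intro sum_mono)
    fix k assume k: "k \<in> {..<length C}"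
    have "set (take k C) \<subseteq> {1..m}"
      using assms(2) set_take_subset by fast
    then have "orbit f (take k C) x \<in> X" "orbit f (take k C) y \<in> X"
      using orbit_into assms(3,4) by (auto simp: word_ball_iff)
    moreover have "C ! k \<in> {1..m}"
      using k assms(2) nth_mem by fastforce
    moreover have "dist (orbit f (take k C) x) (orbit f (take k C) y) < \<epsilon>"
      using k assms(4) by (simp add: word_ball_iff)
    ultimately have "\<bar>\<Phi> (C ! k) (orbit f (take k C) x) - \<Phi> (C ! k) (orbit f (take k C) y)\<bar> \<le> V"
      using osc by (auto simp: osc_le_def)
    then show "\<Phi> (C ! k) (orbit f (take k C) y) \<le> \<Phi> (C ! k) (orbit f (take k C) x) + V"
      by simp
  qed
  also have "\<dots> = word_sum f \<Phi> x C + length C * V"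
    by (simp add: word_sum_def sum.distrib)
  finally show ?thesis .
qed

lemma bounded_potential:
  obtains M where "0 \<le> M" "potential_bound M"
proof -
  have "bounded (\<Union>i\<in>{1..m}. \<Phi> i ` X)"
    using \<Phi>_cont compact_X by (intro bounded_UN compact_imp_bounded ballI compact_continuous_image) auto
  then obtain M where "0 < M" "\<forall>v\<in>(\<Union>i\<in>{1..m}. \<Phi> i ` X). norm v \<le> M"
    unfolding bounded_pos by blast
  then show thesis
    using that[of M] by (fastforce simp: potential_bound_def)
qed

lemma word_sum_ge:
  fixes M :: real
  assumes M: "potential_bound M"
    and "set C \<subseteq> {1..m}" "x \<in> X"
  shows "- (length C * M) \<le> word_sum f \<Phi> x C"
proof -
  have "(\<Sum>k<length C. - M) \<le> word_sum f \<Phi> x C"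
    unfolding word_sum_def
  proof (intro sum_mono)
    fix k assume k: "k \<in> {..<length C}"
    have "set (take k C) \<subseteq> {1..m}"
      using assms(2) set_take_subset by fast
    then have "orbit f (take k C) x \<in> X"
      using orbit_into assms(3) by auto
    moreover have "C ! k \<in> {1..m}"
      using k assms(2) nth_mem by fastforce
    ultimately have "\<bar>\<Phi> (C ! k) (orbit f (take k C) x)\<bar> \<le> M"
      using M unfolding potential_bound_def by blast
    then show "- M \<le> \<Phi> (C ! k) (orbit f (take k C) x)"
      by simp
  qed
  then show ?thesis by simp
qed

section \<open>Concatenating condensed balls along a word\<close>

lemma cond_ball_subset:
  assumes "set C \<subseteq> {1..m}" "length C = n"
  shows "cond_ball X m f n x \<epsilon> \<subseteq> word_ball X f x C \<epsilon>"
proof -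
  have "C \<in> initial_word n ` seqs m"
    using assms m_pos by (simp add: initial_words_eq)
  then show ?thesis
    unfolding cond_ball_def by auto
qed

lemma word_ball_prefix: "word_ball X f x (A @ D) \<epsilon> \<subseteq> word_ball X f x A \<epsilon>"
proof
  fix z assume z: "z \<in> word_ball X f x (A @ D) \<epsilon>"
  have "dist (orbit f (take k A) x) (orbit f (take k A) z) < \<epsilon>" if "k \<le> length A" for k
  proof -
    have "take k (A @ D) = take k A" using that by simp
    then show ?thesis
      using z that unfolding word_ball_iff by (metis length_append trans_le_add1)
  qed
  with z show "z \<in> word_ball X f x A \<epsilon>"
    by (simp add: word_ball_iff)
qed

lemma word_ball_double:
  assumes "y \<in> word_ball X f x C \<epsilon>" "z \<in> word_ball X f x C \<epsilon>"
  shows "z \<in> word_ball X f y C (2 * \<epsilon>)"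
  unfolding word_ball_iff
proof (intro conjI allI impI)
  fix k assume "k \<le> length C"
  then have "dist (orbit f (take k C) x) (orbit f (take k C) y) < \<epsilon>"
    "dist (orbit f (take k C) x) (orbit f (take k C) z) < \<epsilon>"
    using assms by (auto simp: word_ball_iff)
  then show "dist (orbit f (take k C) y) (orbit f (take k C) z) < 2 * \<epsilon>"
    using dist_triangle3[of "orbit f (take k C) y" "orbit f (take k C) z" "orbit f (take k C) x"]
    by simp
qed (use assms in \<open>simp add: word_ball_iff\<close>)

lemma word_ball_append:
  assumes "z \<in> word_ball X f y A \<epsilon>" "orbit f A z \<in> word_ball X f (orbit f A y) D \<epsilon>"
  shows "z \<in> word_ball X f y (A @ D) \<epsilon>"
  unfolding word_ball_iff
proof (intro conjI allI impI)
  fix k assume k: "k \<le> length (A @ D)"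
  show "dist (orbit f (take k (A @ D)) y) (orbit f (take k (A @ D)) z) < \<epsilon>"
  proof (cases "k \<le> length A")
    case True
    then show ?thesis using assms(1) by (simp add: word_ball_iff)
  next
    case False
    then have "take k (A @ D) = A @ take (k - length A) D" "k - length A \<le> length D"
      using k by auto
    then show ?thesis
      using assms(2) by (simp only: word_ball_iff orbit_append)
  qed
qed (use assms in \<open>simp add: word_ball_iff\<close>)

text \<open>Handles a ball that outlasts \<open>C\<close>: the condensed sum dominates the sum over
  a padded word of length \<open>n\<close>, and removing the padding costs at most
  \<open>n * M\<close>.\<close>

lemma piece_short:
  fixes V M :: real
  assumes osc: "osc_le \<epsilon> V"
    and M: "0 \<le> M" "potential_bound M"
    and C: "set C \<subseteq> {1..m}" "length C \<le> n" and x: "x \<in> X"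
  shows "piece X f \<Phi> (2 * \<epsilon>) C (cond_ball X m f n x \<epsilon>)
     (exp (cond_sum m f \<Phi> n x + length C * V + n * M))"
proof -
  define D where "D = replicate (n - length C) (1::nat)"
  have D: "set (C @ D) \<subseteq> {1..m}" "length (C @ D) = n" "set D \<subseteq> {1..m}" "length D \<le> n"
    using C m_pos by (auto simp: D_def)
  have sub: "cond_ball X m f n x \<epsilon> \<subseteq> word_ball X f x C \<epsilon>"
    using cond_ball_subset[OF D(1,2)] word_ball_prefix by blast
  have "orbit f C x \<in> X"
    using orbit_into[OF C(1)] x by blast
  from word_sum_ge[OF M(2) D(3) this] have "- (n * M) \<le> word_sum f \<Phi> (orbit f C x) D"
    using D(4) M(1) mult_right_mono[of "real (length D)" "real n" M] by simp
  then have "word_sum f \<Phi> x C \<le> cond_sum m f \<Phi> n x + n * M"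
    using word_sum_le_cond_sum[OF D(1), of x] D(2) word_sum_append[of f \<Phi> x C D] by simp
  then have "exp (word_sum f \<Phi> y C) \<le> exp (cond_sum m f \<Phi> n x + length C * V + n * M)"
    if "y \<in> cond_ball X m f n x \<epsilon>" for y
    using word_sum_diff_le[OF osc C(1) x, of y] that sub by force
  moreover have "cond_ball X m f n x \<epsilon> \<subseteq> X"
    using sub by (auto simp: word_ball_def)
  ultimately show ?thesis
    unfolding piece_def using sub word_ball_double by (meson exp_ge_zero subsetD)
qed

text \<open>Two points of the ball are \<epsilon>-close to \<open>x\<close>, hence
  \<open>2 * \<epsilon>\<close>-close to each other, along \<open>A\<close>; afterwards their images
  lie in the piece \<open>E\<close>. The radius does not grow, and the weights multiply by the
  cocycle identity.\<close>

lemma piece_append: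
  fixes V :: real
  assumes osc: "osc_le \<epsilon> V"
    and A: "set A \<subseteq> {1..m}" "length A = n" and x: "x \<in> X"
    and E: "piece X f \<Phi> (2 * \<epsilon>) D E w"
  shows "piece X f \<Phi> (2 * \<epsilon>) (A @ D) (cond_ball X m f n x \<epsilon> \<inter> orbit f A -` E)
     (exp (cond_sum m f \<Phi> n x + n * V) * w)"
proof -
  have sub: "cond_ball X m f n x \<epsilon> \<subseteq> word_ball X f x A \<epsilon>"
    by (rule cond_ball_subset[OF A])
  have "z \<in> word_ball X f y (A @ D) (2 * \<epsilon>)"
    if "y \<in> cond_ball X m f n x \<epsilon> \<inter> orbit f A -` E" "z \<in> cond_ball X m f n x \<epsilon> \<inter> orbit f A -` E" for y z
    using that sub E word_ball_double[of y x A \<epsilon> z] unfolding piece_def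
    by (intro word_ball_append) auto
  moreover have "exp (word_sum f \<Phi> y (A @ D)) \<le> exp (cond_sum m f \<Phi> n x + n * V) * w"
    if "y \<in> cond_ball X m f n x \<epsilon> \<inter> orbit f A -` E" for y
  proof -
    have "word_sum f \<Phi> y A \<le> cond_sum m f \<Phi> n x + n * V"
      using word_sum_diff_le[OF osc A(1) x, of y] word_sum_le_cond_sum[OF A(1), of x] that sub A(2)
      by force
    moreover have "exp (word_sum f \<Phi> (orbit f A y) D) \<le> w"
      using that E by (auto simp: piece_def)
    ultimately show ?thesis
      unfolding word_sum_append exp_add[of "word_sum f \<Phi> y A"] by (intro mult_mono) auto
  qed
  moreover have "cond_ball X m f n x \<epsilon> \<subseteq> X"
    using sub by (auto simp: word_ball_def)
  ultimately show ?thesis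
    using E unfolding piece_def by auto
qed

text \<open>Strong induction on \<open>length C\<close>. With
  \<open>S = cond_sum m f \<Phi> (n x) x\<close>, using the ball at \<open>x\<close> first costs
  \<open>exp (S + n x * V)\<close> times the bound for the remaining word, which is
  \<open>exp (S - \<alpha> * n x)\<close> times the bound for \<open>C\<close>. These factors sum to
  at most 1, so the constant does not grow.\<close>

lemma weighted_cover_of_cond_cover:
  fixes V M \<alpha> :: real and L :: nat
  assumes osc: "osc_le \<epsilon> V"
    and M: "0 \<le> M" "potential_bound M"
    and F: "finite F" "F \<subseteq> X" "X \<subseteq> (\<Union>x\<in>F. cond_ball X m f (n x) x \<epsilon>)"
    and n: "\<And>x. x \<in> F \<Longrightarrow> 1 \<le> n x" "\<And>x. x \<in> F \<Longrightarrow> n x \<le> L"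
    and sum_le: "(\<Sum>x\<in>F. exp (cond_sum m f \<Phi> (n x) x - \<alpha> * n x)) \<le> 1"
    and "set C \<subseteq> {1..m}"
  shows "weighted_cover (piece X f \<Phi> (2 * \<epsilon>) C) X (exp (L * (M + \<bar>\<alpha>\<bar>)) * exp ((\<alpha> + V) * length C))"
  using assms(10)
proof (induction "length C" arbitrary: C rule: less_induct)
  case less
  \<comment> \<open>\<open>K\<close> pays for the last ball, whose length may overshoot the end of \<open>C\<close> by up to \<open>L\<close>.\<close>
  define K where "K = exp (L * (M + \<bar>\<alpha>\<bar>))"
  define R where "R = K * exp ((\<alpha> + V) * length C)"
  have ball: "weighted_cover (piece X f \<Phi> (2 * \<epsilon>) C) (cond_ball X m f (n x) x \<epsilon>)
      (R * exp (cond_sum m f \<Phi> (n x) x - \<alpha> * n x))" if "x \<in> F" for x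
  proof (cases "n x \<le> length C")
    case True
    \<comment> \<open>Since \<open>n x \<ge> 1\<close>, the remainder \<open>D\<close> is strictly
      shorter than \<open>C\<close>.\<close>
    define A where "A = take (n x) C"
    define D where "D = drop (n x) C"
    have C: "C = A @ D" and A: "set A \<subseteq> {1..m}" "length A = n x" and D: "set D \<subseteq> {1..m}"
      "length D < length C" "length C = n x + length D"
      using less.prems True n(1)[OF that] set_take_subset[of "n x" C] set_drop_subset[of "n x" C]
      by (auto simp: A_def D_def)
    have x: "x \<in> X" using F(2) that by blast
    have "weighted_cover (piece X f \<Phi> (2 * \<epsilon>) D) X (K * exp ((\<alpha> + V) * length D))"
      unfolding K_def using D by (intro less.hyps)
    then have "weighted_cover (piece X f \<Phi> (2 * \<epsilon>) C) (cond_ball X m f (n x) x \<epsilon> \<inter> orbit f A -` X)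
      (exp (cond_sum m f \<Phi> (n x) x + n x * V) * (K * exp ((\<alpha> + V) * length D)))"
      by (rule weighted_cover_transfer) (simp_all add: C piece_append[OF osc A x] del: rev_append)
    \<comment> \<open>The orbit map sends \<open>X\<close> into itself, so pulling back
      \<open>X\<close> removes nothing from the ball.\<close>
    moreover have "cond_ball X m f (n x) x \<epsilon> \<inter> orbit f A -` X = cond_ball X m f (n x) x \<epsilon>"
      using cond_ball_subset[OF A, of x \<epsilon>] orbit_into[OF A(1)] by (auto 0 4 simp: word_ball_iff)
    moreover have "exp (cond_sum m f \<Phi> (n x) x + n x * V) * (K * exp ((\<alpha> + V) * length D)) =
        R * exp (cond_sum m f \<Phi> (n x) x - \<alpha> * n x)"
      by (simp add: R_def D(3) algebra_simps flip: exp_add)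
    ultimately show ?thesis by simp
  next
    case False
    have x: "x \<in> X" using F(2) that by blast
    \<comment> \<open>A cover by a single piece; the empty union and zero weight match the rule
      \<open>insert\<close>.\<close>
    have "weighted_cover (piece X f \<Phi> (2 * \<epsilon>) C) (cond_ball X m f (n x) x \<epsilon> \<union> {})
      (exp (cond_sum m f \<Phi> (n x) x + length C * V + n x * M) + 0)"
      using False by (intro weighted_cover.intros piece_short osc M less.prems x) auto
    moreover have "exp (cond_sum m f \<Phi> (n x) x + length C * V + n x * M) \<le>
        R * exp (cond_sum m f \<Phi> (n x) x - \<alpha> * n x)"
    proof -
      \<comment> \<open>The absolute value allows for negative \<alpha>; the overshoot
        \<open>n x - length C\<close> is at most \<open>L\<close>.\<close>
      have "\<alpha> * (real (n x) - length C) \<le> \<bar>\<alpha>\<bar> * (real (n x) - length C)"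
        using False by (intro mult_right_mono) auto
      also have "\<dots> \<le> \<bar>\<alpha>\<bar> * L"
        using n(2)[OF that] by (intro mult_left_mono) auto
      finally have "\<alpha> * (real (n x) - length C) \<le> \<bar>\<alpha>\<bar> * L" .
      moreover have "n x * M \<le> L * M"
        using n(2)[OF that] M(1) by (intro mult_right_mono) auto
      ultimately show ?thesis
        by (simp add: R_def K_def algebra_simps flip: exp_add)
    qed
    ultimately show ?thesis
      by (auto intro: weighted_cover_mono)
  qed
  have "(\<Union>x\<in>F. cond_ball X m f (n x) x \<epsilon>) = X"
  proof
    show "(\<Union>x\<in>F. cond_ball X m f (n x) x \<epsilon>) \<subseteq> X"
      using openin_cond_ball openin_imp_subset by blast
  qed (fact F(3))
  moreover have "weighted_cover (piece X f \<Phi> (2 * \<epsilon>) C) (\<Union>x\<in>F. cond_ball X m f (n x) x \<epsilon>)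
      (\<Sum>x\<in>F. R * exp (cond_sum m f \<Phi> (n x) x - \<alpha> * n x))"
    using F(1) ball by (rule weighted_cover_UN)
  ultimately have
    "weighted_cover (piece X f \<Phi> (2 * \<epsilon>) C) X (\<Sum>x\<in>F. R * exp (cond_sum m f \<Phi> (n x) x - \<alpha> * n x))"
    by simp
  moreover have "(\<Sum>x\<in>F. R * exp (cond_sum m f \<Phi> (n x) x - \<alpha> * n x)) \<le> R"
    using mult_left_mono[OF sum_le, of R] by (simp add: R_def K_def sum_distrib_left)
  ultimately show ?case
    unfolding R_def K_def by (rule weighted_cover_mono)
qed

section \<open>Free against upper condensed pressure\<close>

lemma cond_lim_zeroE:
  assumes "cond_lim X m f \<Phi> \<alpha> \<epsilon> = 0"
  obtains F n where "finite F" "F \<subseteq> X" "X \<subseteq> (\<Union>x\<in>F. cond_ball X m f (n x) x \<epsilon>)"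
    "\<And>x. x \<in> F \<Longrightarrow> 1 \<le> n x" "(\<Sum>x\<in>F. exp (cond_sum m f \<Phi> (n x) x - \<alpha> * real (n x))) \<le> 1"
proof -
  \<comment> \<open>\<open>cond_M\<close> increases with \<open>N\<close>, so its value at 1 is
    already 0; \<open>N = 1\<close> provides the positive lengths that the induction on words
    needs.\<close>
  have "cond_M X m f \<Phi> \<alpha> 1 \<epsilon> \<le> cond_lim X m f \<Phi> \<alpha> \<epsilon>"
    by (rule incseq_le[OF _ cond_M_LIMSEQ]) (simp add: incseq_SucI cond_M_mono)
  then have "cond_M X m f \<Phi> \<alpha> 1 \<epsilon> < 1"
    using assms by simp
  then obtain F n where F: "F \<subseteq> X" "\<forall>x\<in>F. 1 \<le> n x" "X \<subseteq> (\<Union>x\<in>F. cond_ball X m f (n x) x \<epsilon>)"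
    "(\<Sum>\<^sub>\<infinity>x\<in>F. ennreal (exp (cond_sum m f \<Phi> (n x) x - \<alpha> * real (n x)))) < 1"
    unfolding cond_M_def Inf_less_iff by blast
  obtain F' where F': "finite F'" "F' \<subseteq> F" "X \<subseteq> (\<Union>x\<in>F'. cond_ball X m f (n x) x \<epsilon>)"
    using finite_subcover[OF F(3) openin_cond_ball] by metis
  have "(\<Sum>x\<in>F'. ennreal (exp (cond_sum m f \<Phi> (n x) x - \<alpha> * real (n x)))) \<le> 1"
    using order.trans[OF finite_infsum_le_ennreal[OF F'(1,2)] less_imp_le[OF F(4)]] .
  then have "(\<Sum>x\<in>F'. exp (cond_sum m f \<Phi> (n x) x - \<alpha> * real (n x))) \<le> 1"
    by (simp add: sum_nonneg)
  with F F' show thesis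
    using that[of F' n] by blast
qed

lemma free_le_cond_scale:
  fixes V :: real
  assumes osc: "osc_le \<epsilon> V"
    and "cond_lim X m f \<Phi> \<alpha> \<epsilon> = 0"
  shows "free_pressure_scale X m f \<Phi> (2 * \<epsilon>) \<le> ereal (\<alpha> + V)"
proof -
  obtain M where M: "0 \<le> M" "potential_bound M"
    using bounded_potential by blast
  obtain F n where F: "finite F" "F \<subseteq> X" "X \<subseteq> (\<Union>x\<in>F. cond_ball X m f (n x) x \<epsilon>)"
    "\<And>x. x \<in> F \<Longrightarrow> 1 \<le> n x" "(\<Sum>x\<in>F. exp (cond_sum m f \<Phi> (n x) x - \<alpha> * real (n x))) \<le> 1"
    using cond_lim_zeroE[OF assms(2)] by blast
  obtain L where L: "\<And>x. x \<in> F \<Longrightarrow> n x \<le> L"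
    using finite_nat_set_iff_bounded_le[of "n ` F"] F(1) by auto
  \<comment> \<open>The logarithm of the constant factor in the cover bound; it is independent of
    the word and vanishes after division by its length.\<close>
  define \<kappa> where "\<kappa> = L * (M + \<bar>\<alpha>\<bar>)"
  have cover: "word_cover_inf X f \<Phi> C (2 * \<epsilon>) \<le> ennreal (exp (\<kappa> + (\<alpha> + V) * length C))"
    if C: "set C \<subseteq> {1..m}" for C
  proof -
    have "weighted_cover (piece X f \<Phi> (2 * \<epsilon>) C) X (exp (\<kappa> + (\<alpha> + V) * length C))"
      unfolding \<kappa>_def exp_add by (rule weighted_cover_of_cond_cover[OF osc M F(1-4) L F(5) C])
    then obtain Y where Y: "finite Y" "Y \<subseteq> X" "X \<subseteq> (\<Union>y\<in>Y. word_ball X f y C (2 * \<epsilon>))"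
      "(\<Sum>y\<in>Y. exp (word_sum f \<Phi> y C)) \<le> exp (\<kappa> + (\<alpha> + V) * length C)"
      by (rule weighted_cover_centers)
    then have "X = (\<Union>y\<in>Y. word_ball X f y C (2 * \<epsilon>))"
      by (auto simp: word_ball_def)
    then have "word_cover_inf X f \<Phi> C (2 * \<epsilon>) \<le> (\<Sum>\<^sub>\<infinity>y\<in>Y. ennreal (exp (word_sum f \<Phi> y C)))"
      unfolding word_cover_inf_def using Y(2) by (intro Inf_lower) blast
    also have "\<dots> = ennreal (\<Sum>y\<in>Y. exp (word_sum f \<Phi> y C))"
      using Y(1) by simp
    also have "\<dots> \<le> ennreal (exp (\<kappa> + (\<alpha> + V) * length C))"
      using Y(4) by (rule ennreal_leI)
    finally show ?thesis .
  qed
  have "free_pressure_scale X m f \<Phi> (2 * \<epsilon>) \<le> limsup (\<lambda>n. ereal (\<kappa> / n + (\<alpha> + V)))"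
    unfolding free_pressure_scale_def
  proof (rule Limsup_mono, use eventually_ge_at_top[of 1] in eventually_elim)
    case (elim n)
    have "elog (free_average X m f \<Phi> n (2 * \<epsilon>)) \<le> elog (ennreal (exp (\<kappa> + (\<alpha> + V) * n)))"
      using cover elim by (intro elog_mono free_average_leI) auto
    then have "ereal (1 / n) * elog (free_average X m f \<Phi> n (2 * \<epsilon>)) \<le>
        ereal (1 / n) * ereal (\<kappa> + (\<alpha> + V) * n)"
      by (intro ereal_mult_left_mono) (auto simp: elog_ennreal)
    also have "\<dots> = ereal (\<kappa> / n + (\<alpha> + V))"
      using elim by (simp add: field_simps)
    finally show ?case .
  qed
  also have "(\<lambda>n. \<kappa> / real n + (\<alpha> + V)) \<longlonglongrightarrow> 0 + (\<alpha> + V)"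
    by (intro tendsto_intros lim_const_over_n)
  then have "limsup (\<lambda>n. ereal (\<kappa> / n + (\<alpha> + V))) = ereal (\<alpha> + V)"
    by (intro lim_imp_Limsup) auto
  finally show ?thesis .
qed

text \<open>Uniform continuity on the compact \<open>X\<close>, with the smallest of the finitely
  many moduli.\<close>

lemma potential_oscillation:
  assumes "0 < V"
  obtains \<delta> where "0 < \<delta>" "osc_le \<delta> V"
proof -
  have "\<exists>d>0. \<forall>x\<in>X. \<forall>y\<in>X. dist x y < d \<longrightarrow> \<bar>\<Phi> i x - \<Phi> i y\<bar> \<le> V" if "i \<in> {1..m}" for i
  proof -
    have "uniformly_continuous_on X (\<Phi> i)"
      using compact_uniformly_continuous[OF \<Phi>_cont compact_X] that by blast
    then obtain d where "d > 0" "\<forall>x\<in>X. \<forall>x'\<in>X. dist x' x < d \<longrightarrow> dist (\<Phi> i x') (\<Phi> i x) < V"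
      unfolding uniformly_continuous_on_def using assms by blast
    then show ?thesis
      by (intro exI[of _ d]) (auto simp: dist_real_def less_imp_le)
  qed
  then obtain d where d: "\<And>i. i \<in> {1..m} \<Longrightarrow> d i > 0"
    "\<And>i x y. i \<in> {1..m} \<Longrightarrow> x \<in> X \<Longrightarrow> y \<in> X \<Longrightarrow> dist x y < d i \<Longrightarrow> \<bar>\<Phi> i x - \<Phi> i y\<bar> \<le> V"
    by metis
  show thesis
  proof (rule that[of "Min (d ` {1..m})"])
    show "0 < Min (d ` {1..m})" using d(1) m_pos by auto
    show "osc_le (Min (d ` {1..m})) V"
      unfolding osc_le_def using d(2) by simp
  qed
qed

lemma cond_scale_le_pressure:
  assumes "0 < \<epsilon>"
  shows "cond_pressure_scale X m f \<Phi> \<epsilon> \<le> upper_cond_pressure X m f \<Phi>"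
proof (rule tendsto_lowerbound[OF cond_pressure_tendsto])
  show "\<forall>\<^sub>F e in at_right 0. cond_pressure_scale X m f \<Phi> \<epsilon> \<le> cond_pressure_scale X m f \<Phi> e"
    using eventually_at_right_less[of 0] eventually_at_right_real[OF assms]
    by eventually_elim (auto intro: cond_pressure_scale_antimono)
qed simp

text \<open>Doubling the scale is harmless in the limit, and the oscillation loss \<open>V\<close>
  is arbitrarily small.\<close>

lemma free_le_cond: "free_pressure X m f \<Phi> \<le> upper_cond_pressure X m f \<Phi>"
proof (rule ereal_le_epsilon2)
  fix V :: real assume "0 < V"
  then obtain \<delta> where \<delta>: "0 < \<delta>" "osc_le \<delta> V"
    by (rule potential_oscillation)
  show "free_pressure X m f \<Phi> \<le> upper_cond_pressure X m f \<Phi> + ereal V"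
  proof (rule tendsto_upperbound[OF free_pressure_tendsto])
    show "\<forall>\<^sub>F e in at_right 0. free_pressure_scale X m f \<Phi> e \<le> upper_cond_pressure X m f \<Phi> + ereal V"
      using eventually_at_right_real[OF \<delta>(1)]
    proof eventually_elim
      case (elim e)
      define \<epsilon> where "\<epsilon> = e / 2"
      have \<epsilon>: "0 < \<epsilon>" "\<epsilon> < \<delta>" "e = 2 * \<epsilon>" using elim by (auto simp: \<epsilon>_def)
      have osc: "osc_le \<epsilon> V"
        using \<delta>(2) \<epsilon>(2) by (auto simp: osc_le_def)
      \<comment> \<open>With the finite \<open>V\<close> moved to the left, it suffices to bound
        each admissible \<alpha> from below; if there is none, the infimum is infinite.\<close>
      have "free_pressure_scale X m f \<Phi> e - ereal V \<le> cond_pressure_scale X m f \<Phi> \<epsilon>"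
        unfolding cond_pressure_scale_def
      proof (rule Inf_greatest)
        fix a assume "a \<in> {ereal \<alpha> | \<alpha>. cond_lim X m f \<Phi> \<alpha> \<epsilon> = 0}"
        then obtain \<alpha> where "a = ereal \<alpha>" "cond_lim X m f \<Phi> \<alpha> \<epsilon> = 0" by blast
        with free_le_cond_scale[OF osc, of \<alpha>] show "free_pressure_scale X m f \<Phi> e - ereal V \<le> a"
          by (simp add: \<epsilon>(3) ereal_minus_le_iff add.commute)
      qed
      also have "\<dots> \<le> upper_cond_pressure X m f \<Phi>"
        using \<epsilon>(1) by (rule cond_scale_le_pressure)
      finally show ?case
        by (simp add: ereal_minus_le_iff add.commute)
    qed
  qed simp
qed

lemma amalg_le_free: "amalg_pressure X m f \<Phi> \<le> free_pressure X m f \<Phi>"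
  by (rule tendsto_le[OF _ free_pressure_tendsto amalg_pressure_tendsto])
    (simp_all add: amalg_le_free_scale)

end

theorem theorem3p19:
  fixes X :: "'a::metric_space set"
    and m :: nat
    and f :: "nat \<Rightarrow> 'a \<Rightarrow> 'a"
    and \<Phi> :: "nat \<Rightarrow> 'a \<Rightarrow> real"
  assumes "compact X"
    and "m \<ge> 1"
    and "\<And>i. i \<in> {1..m} \<Longrightarrow> f i ` X \<subseteq> X"
    and "\<And>i. i \<in> {1..m} \<Longrightarrow> continuous_on X (f i)"
    and "\<And>i. i \<in> {1..m} \<Longrightarrow> continuous_on X (\<Phi> i)"
  shows "amalg_pressure X m f \<Phi> \<le> free_pressure X m f \<Phi> \<and>
         free_pressure X m f \<Phi> \<le> upper_cond_pressure X m f \<Phi>"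
proof -
  interpret free_system X m f \<Phi>
    using assms by unfold_locales
  show ?thesis
    using amalg_le_free free_le_cond by blast
qed

end
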